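(* Let $p$ be an odd prime, $m$ a positive integer, $q=p^m$, $s>1$ a positive integer, and $a\in\mu_{q^2+q+1}=\{x\in\mathbb{F}_{q^3}: x^{q^2+q+1}=1\}$. Let $$f_2(X)=2X^{q^2}+(a+a^q)X^q+\left(a^{1+q^2}+a^{1+q}\right)X+\mathrm{Tr}_m^{3m}(X)^s\in\mathbb{F}_{q^3}[X].$$ Then: (1) if $q\equiv 0\pmod 3$, $f_2(X)$ is a permutation polynomial of $\mathbb{F}_{q^3}$ if and only if $a$ is a solution of neither of the equations $X^{q+1}+X+1=0$ and $X^{q+1}+X^q+1=0$, and $\gcd(s,q-1)=1$; (2) if $q\equiv 1\pmod 3$, $f_2(X)$ is a permutation polynomial of $\mathbb{F}_{q^3}$ if and only if $a$ is a solution of none of the equations $X^{q+1}+\frac{1+\alpha}{1-\alpha}X-\frac{2}{1-\alpha}=0$, $X^{q+1}+\frac{1-\alpha}{1+\alpha}X-\frac{2}{1+\alpha}=0$, $2X^{q+1}-(1-\beta)X^q-(1+\beta)=0$ and $2X^{q+1}-(1+\beta)X^q-(1-\beta)=0$, where $\alpha,\beta\in\mathbb{F}_{q^3}$ satisfy $\alpha^2=\beta^2=-3$, and $\gcd(s,q-1)=1$; (3) if $q\equiv 2\pmod 3$, $f_2(X)$ is a permutation polynomial of $\mathbb{F}_{q^3}$ if and only if $a\neq 1$ and $\gcd(s,q-1)=1$.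
   Context: $\mathrm{Tr}_m^{3m}(X)=X+X^q+X^{q^2}$ is the relative trace from $\mathbb{F}_{q^3}$ to $\mathbb{F}_q$. A polynomial $f\in\mathbb{F}_{q^3}[X]$ is a permutation polynomial of $\mathbb{F}_{q^3}$ if $c\mapsto f(c)$ is a bijection of $\mathbb{F}_{q^3}$. *)

theory Defs
  imports
    "HOL-Library.Cardinality"
    "HOL-Number_Theory.Cong"
    "HOL-Computational_Algebra.Primes"
    "HOL-Computational_Algebra.Polynomial"
begin

definition permutation_poly :: "'a::finite_field poly \<Rightarrow> bool" where
  "permutation_poly f \<longleftrightarrow> bij (poly f)"

definition roots_of_unity :: "nat \<Rightarrow> 'a::finite_field set" where
  "roots_of_unity n = {x. x ^ n = 1}"

(* The relative trace from the field with q^3 elements to its subfield with q elements,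
   as a polynomial. *)
definition trace_poly :: "nat \<Rightarrow> 'a::finite_field poly" where
  "trace_poly q = monom 1 1 + monom 1 q + monom 1 (q ^ 2)"

definition f2 :: "nat \<Rightarrow> nat \<Rightarrow> 'a::finite_field \<Rightarrow> 'a poly" where
  "f2 q s a =
     monom 2 (q ^ 2) + monom (a + a ^ q) q + monom (a ^ (1 + q ^ 2) + a ^ (1 + q)) 1
       + trace_poly q ^ s"

end

theory Submission
  imports Defs "HOL-Number_Theory.Residues"
begin

text \<open>
  By Hilbert's Theorem 90, a = w / w^q for some nonzero w, and then the linear part of the polynomial
  at x is Tr(w x) v^(q^2) + Tr(w^(q^2) x) v^q with v = 1/w. Hence f2 factors through the map sending
  x to (Tr(w x), Tr(w^(q^2) x), Tr(x)) in F_q^3, followed by the map sending (A, B, T) to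
  A v^(q^2) + B v^q + T^s. Both are bijective iff w, w^(q^2), 1 are linearly independent over F_q,
  v^(q^2), v^q, 1 are linearly independent over F_q, and T^s permutes F_q. The two independence conditions are
  the nonvanishing of D(w) and D(v), where D(w) = w0^2 + w1^2 + w2^2 - w0 w1 - w1 w2 - w0 w2 in terms of
  the conjugates of w. This form is a square in characteristic 3, splits over cube roots of unity
  when q = 1 mod 3, and vanishes only for w0 = w1 = w2 when q = 2 mod 3.
\<close>

section \<open>The Frobenius automorphism and the trace of a cubic extension\<close>

text \<open>Additivity of \<open>\<phi>\<close> encodes that \<open>q\<close> is a power of the
  characteristic. The cardinality makes \<open>\<phi>\<close> of order dividing three, so its fixed
  points play the role of F_q.\<close>

locale cubic_frobenius =
  fixes q :: nat and \<phi> :: "'a::finite_field \<Rightarrow> 'a"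
  assumes card: "CARD('a) = q ^ 3"
    and frob: "\<phi> x = x ^ q"
    and frob_add: "\<phi> (x + y) = \<phi> x + \<phi> y"
begin

definition tr :: "'a \<Rightarrow> 'a" where
  "tr x = x + \<phi> x + \<phi> (\<phi> x)"

(* The determinant of the matrix with rows (w, w^(q^2), 1), (w^q, w, 1), (w^(q^2), w^q, 1). *)
definition disc :: "'a \<Rightarrow> 'a" where
  "disc w = w\<^sup>2 + (\<phi> w)\<^sup>2 + (\<phi> (\<phi> w))\<^sup>2 - w * \<phi> w - \<phi> w * \<phi> (\<phi> w) - w * \<phi> (\<phi> w)"

lemma q_gt_1: "q > 1"
proof -
  have "card {0, 1 :: 'a} \<le> CARD('a)"
    by (rule card_mono) auto
  then have "q ^ 3 \<ge> 2"
    by (simp add: card)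
  then show ?thesis
    by (cases "q = 0 \<or> q = 1") auto
qed

lemma frob_0 [simp]: "\<phi> 0 = 0"
  using q_gt_1 by (simp add: frob)

lemma frob_1 [simp]: "\<phi> 1 = 1"
  by (simp add: frob)

lemma frob_mult: "\<phi> (x * y) = \<phi> x * \<phi> y"
  by (simp add: frob power_mult_distrib)

lemma frob_divide: "\<phi> (x / y) = \<phi> x / \<phi> y"
  by (simp add: frob power_divide)

lemma frob_diff: "\<phi> (x - y) = \<phi> x - \<phi> y"
  using frob_add[of "x - y" y] by (simp add: algebra_simps)

lemma frob_power: "\<phi> (x ^ n) = \<phi> x ^ n"
  by (simp add: frob mult.commute flip: power_mult)

lemma frob_eq_0_iff [simp]: "\<phi> x = 0 \<longleftrightarrow> x = 0"
  using q_gt_1 by (simp add: frob)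

lemma frob_cube [simp]: "\<phi> (\<phi> (\<phi> x)) = x"
  using finite_field_power_card_eq_same[of x]
  by (simp add: frob card power3_eq_cube mult.assoc flip: power_mult)

lemma frob_inject [simp]: "\<phi> x = \<phi> y \<longleftrightarrow> x = y"
  by (metis frob_cube)

lemma frob_square: "\<phi> (\<phi> x) = x ^ q\<^sup>2"
  by (simp add: frob power2_eq_square flip: power_mult)

lemmas frob_simps = frob_add frob_diff frob_mult frob_power frob_divide

lemma frob_tr: "\<phi> (tr x) = tr x"
  by (simp add: tr_def frob_simps)

lemma tr_add: "tr (x + y) = tr x + tr y"
  by (simp add: tr_def frob_simps)

lemma tr_diff: "tr (x - y) = tr x - tr y"
  by (simp add: tr_def frob_simps)

lemma tr_scale: "\<phi> c = c \<Longrightarrow> tr (c * x) = c * tr x"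
  by (simp add: tr_def frob_simps algebra_simps)

lemma frob_disc: "\<phi> (disc w) = disc w"
  by (simp add: disc_def frob_simps)

text \<open>The left-hand side is a polynomial in \<open>t\<close> of degree at most q^2, too small
  to have all q^3 field elements as roots unless it is zero. The exponents 1, q, q^2 are distinct,
  so its coefficients can be read off one by one.\<close>

lemma vanishing_coeffs:
  assumes "\<And>t. c0 * t + c1 * \<phi> t + c2 * \<phi> (\<phi> t) = 0"
  shows "c0 = 0" "c1 = 0" "c2 = 0"
proof -
  define g where "g = Polynomial.monom c0 1 + Polynomial.monom c1 q + Polynomial.monom c2 (q\<^sup>2)"
  have q: "1 < q" "q < q\<^sup>2" "q\<^sup>2 < q ^ 3"
    using q_gt_1 by (simp_all add: power2_eq_square power3_eq_cube)
  have root: "poly g t = 0" for t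
    using assms[of t] by (simp add: g_def poly_monom frob_square flip: frob)
  have "g = 0"
  proof (rule ccontr)
    assume "g \<noteq> 0"
    then have "CARD('a) \<le> degree g"
      using card_poly_roots_bound[of g] root by simp
    also have "degree g \<le> q\<^sup>2"
      unfolding g_def using q by (intro degree_add_le order.trans[OF degree_monom_le]) auto
    finally show False
      using q card by simp
  qed
  then have "Polynomial.coeff g n = 0" for n
    by simp
  from this[of 1] this[of q] this[of "q\<^sup>2"] q
  show "c0 = 0" "c1 = 0" "c2 = 0"
    by (auto simp: g_def)
qed

text \<open>The witness is the resolvent t + a \<phi>(t) + a \<phi>(a) \<phi>(\<phi>(t)). Applying
  \<open>\<phi>\<close> and multiplying by \<open>a\<close> permutes its summands cyclically because
  \<open>a\<close> has norm 1. Some \<open>t\<close> makes it nonzero, since the coefficient of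
  \<open>t\<close> is 1.\<close>

lemma hilbert_90:
  assumes "a * \<phi> a * \<phi> (\<phi> a) = 1"
  obtains w where "w \<noteq> 0" and "w = a * \<phi> w"
proof -
  from assms vanishing_coeffs(1)[of 1 a "a * \<phi> a"]
  obtain t where t: "t + a * \<phi> t + a * \<phi> a * \<phi> (\<phi> t) \<noteq> 0"
    by auto
  moreover have "t + a * \<phi> t + a * \<phi> a * \<phi> (\<phi> t) = a * \<phi> (t + a * \<phi> t + a * \<phi> a * \<phi> (\<phi> t))"
    using assms by (simp add: frob_simps distrib_left flip: mult.assoc)
  ultimately show thesis
    using that by blast
qed

section \<open>The form \<open>disc\<close> as the determinant of trace systems\<close>

text \<open>If \<open>w\<close> is fixed by \<open>\<phi>\<close>, all three conditions reduce to
  trace zero, and any nonzero \<phi>(t) - t serves. Otherwise \<phi>(\<phi>(w)) - \<phi>(w)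
  satisfies the first two trace conditions identically, and its third trace equals
  \<open>disc w\<close>.\<close>

lemma disc_eq_0_imp_kernel:
  assumes "disc w = 0"
  obtains d where "d \<noteq> 0" "tr d = 0" "tr (w * d) = 0" "tr (\<phi> (\<phi> w) * d) = 0"
proof (cases "\<phi> w = w")
  case True
  obtain t where t: "\<phi> t \<noteq> t"
    using vanishing_coeffs(2)[of "-1" 1 0] by auto
  have *: "tr (\<phi> t - t) = 0"
    by (simp add: tr_def frob_simps)
  have "\<phi> t - t \<noteq> 0"
    using t by simp
  from that[OF this *] show thesis
    using * True by (simp add: tr_scale)
next
  case False
  show thesis
  proof (rule that)
    show "\<phi> (\<phi> w) - \<phi> w \<noteq> 0"
      using False by simp
    show "tr (\<phi> (\<phi> w) - \<phi> w) = 0" "tr (w * (\<phi> (\<phi> w) - \<phi> w)) = 0"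
      by (simp_all add: tr_def frob_simps algebra_simps)
    show "tr (\<phi> (\<phi> w) * (\<phi> (\<phi> w) - \<phi> w)) = 0"
      using assms by (simp add: tr_def disc_def frob_simps power2_eq_square algebra_simps)
  qed
qed

lemma disc_neq_0_imp_trivial_kernel:
  assumes "disc w \<noteq> 0" "tr d = 0" "tr (w * d) = 0" "tr (\<phi> (\<phi> w) * d) = 0"
  shows "d = 0"
proof -
  \<comment> \<open>Cramer's rule: the row of conjugates of \<open>d\<close> times the matrix of
    determinant \<open>disc w\<close> is the row of the three traces. The coefficients here are the
    cofactors of the first row of that matrix.\<close>
  have "disc w * d = (w - \<phi> w) * tr (w * d) + (\<phi> (\<phi> w) - \<phi> w) * tr (\<phi> (\<phi> w) * d)
      + ((\<phi> w)\<^sup>2 - \<phi> (\<phi> w) * w) * tr d"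
    by (simp add: tr_def disc_def frob_simps power2_eq_square algebra_simps)
  then have "disc w * d = 0"
    using assms(2-4) by simp
  with assms(1) show ?thesis
    by simp
qed

text \<open>Conjugating the relation twice gives three equations with the same coefficients.
  Eliminating \<open>C\<close> leaves a 2 by 2 system in \<open>A\<close> and \<open>B\<close> whose
  determinant is \<open>disc v\<close>.\<close>

lemma disc_neq_0_imp_independent:
  assumes "disc v \<noteq> 0" and fixed: "\<phi> A = A" "\<phi> B = B" "\<phi> C = C"
    and rel: "A * \<phi> (\<phi> v) + B * \<phi> v + C = 0"
  shows "A = 0" "B = 0" "C = 0"
proof -
  have rel1: "A * v + B * \<phi> (\<phi> v) + C = 0"
    using arg_cong[OF rel, of \<phi>] fixed by (simp add: frob_simps)
  have rel2: "A * \<phi> v + B * v + C = 0"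
    using arg_cong[OF rel1, of \<phi>] fixed by (simp add: frob_simps)
  have eq1: "A * (v - \<phi> (\<phi> v)) + B * (\<phi> (\<phi> v) - \<phi> v) = 0"
    and eq2: "A * (\<phi> v - \<phi> (\<phi> v)) + B * (v - \<phi> v) = 0"
    using rel rel1 rel2 by (simp_all add: right_diff_distrib add_eq_0_iff2) (simp_all add: algebra_simps)
  have "disc v * A = (v - \<phi> v) * (A * (v - \<phi> (\<phi> v)) + B * (\<phi> (\<phi> v) - \<phi> v))
      - (\<phi> (\<phi> v) - \<phi> v) * (A * (\<phi> v - \<phi> (\<phi> v)) + B * (v - \<phi> v))"
    by (simp add: disc_def power2_eq_square algebra_simps)
  with assms(1) show A: "A = 0"
    by (simp add: eq1 eq2)
  have "disc v * B = (v - \<phi> (\<phi> v)) * (A * (\<phi> v - \<phi> (\<phi> v)) + B * (v - \<phi> v))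
      - (\<phi> v - \<phi> (\<phi> v)) * (A * (v - \<phi> (\<phi> v)) + B * (\<phi> (\<phi> v) - \<phi> v))"
    by (simp add: disc_def power2_eq_square algebra_simps)
  with assms(1) show B: "B = 0"
    by (simp add: eq1 eq2)
  show "C = 0"
    using rel A B by simp
qed

section \<open>The power map on the fixed field\<close>

(* A nontrivial common factor g of s and q - 1 yields the nontrivial g-th root of unity
   y^((q^3 - 1)/g); it is an s-th root of unity fixed by the Frobenius map. *)
lemma nontrivial_root_of_unity:
  assumes "gcd s (q - 1) \<noteq> 1"
  obtains z where "z \<noteq> 1" "\<phi> z = z" "z ^ s = 1"
proof -
  define g where "g = gcd s (q - 1)"
  have g: "g dvd s" "g dvd q - 1" "g > 1"
    using assms q_gt_1 unfolding g_def by (auto simp: nat_neq_iff)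
  obtain k where k: "q - 1 = g * k"
    using g(2) by blast
  have "q - 1 > 0"
    using q_gt_1 by simp
  then have kpos: "k > 0"
    using k by (cases k) auto
  have *: "q ^ 3 - 1 = (q - 1) * (q\<^sup>2 + q + 1)"
    using q_gt_1 by (simp add: power2_eq_square power3_eq_cube diff_mult_distrib algebra_simps)
  define n where "n = k * (q\<^sup>2 + q + 1)"
  have n: "q ^ 3 - 1 = g * n" "n > 0"
    unfolding n_def * k using kpos by (simp_all only: mult.assoc) simp
  \<comment> \<open>Otherwise X^n - 1 would have q^3 - 1 = g n > n roots.\<close>
  have "\<exists>y :: 'a. y \<noteq> 0 \<and> y ^ n \<noteq> 1"
  proof (rule ccontr)
    assume "\<not> ?thesis"
    then have sub: "UNIV - {0} \<subseteq> {y :: 'a. poly (Polynomial.monom 1 n - 1) y = 0}"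
      by (auto simp: poly_monom)
    have nz: "Polynomial.monom 1 n - 1 \<noteq> (0 :: 'a poly)"
    proof
      assume "Polynomial.monom 1 n - 1 = (0 :: 'a poly)"
      then have "Polynomial.coeff (Polynomial.monom 1 n - 1 :: 'a poly) n = 0" by simp
      then show False using n(2) by simp
    qed
    have "card (UNIV - {0 :: 'a}) \<le> card {y :: 'a. poly (Polynomial.monom 1 n - 1) y = 0}"
      using sub by (intro card_mono) auto
    also have "\<dots> \<le> degree (Polynomial.monom 1 n - 1 :: 'a poly)"
      by (rule card_poly_roots_bound[OF nz])
    also have "\<dots> \<le> n"
      by (intro degree_diff_le degree_monom_le) simp
    finally have "q ^ 3 - 1 \<le> n"
      by (simp add: card card_Diff_subset)
    with n g(3) show False
      by simp
  qed
  then obtain y :: 'a where y: "y \<noteq> 0" "y ^ n \<noteq> 1"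
    by blast
  have "y ^ (q ^ 3) = y"
    using finite_field_power_card_eq_same[of y] card by simp
  then have "y * y ^ (q ^ 3 - 1) = y"
    using q_gt_1 by (simp flip: power_Suc)
  then have "y ^ (n * g) = 1"
    using y(1) n(1) by (simp add: mult.commute)
  then have zg: "(y ^ n) ^ j = 1" if "g dvd j" for j
    using that by (auto simp: power_mult)
  have "\<phi> (y ^ n) = (y ^ n) ^ Suc (q - 1)"
    using q_gt_1 by (simp add: frob)
  also have "\<dots> = y ^ n"
    using zg[OF g(2)] by (simp only: power_Suc) simp
  finally have yn: "\<phi> (y ^ n) = y ^ n" .
  show thesis
    by (rule that[OF y(2) yn zg[OF g(1)]])
qed

text \<open>For nonzero \<open>y\<close>, the quotient x / y is killed by both exponents
  \<open>s\<close> and \<open>q - 1\<close>, so Bezout makes it 1.\<close>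

lemma power_inject_fixed:
  assumes "gcd s (q - 1) = 1" "s > 0" "\<phi> x = x" "\<phi> y = y" "x ^ s = y ^ s"
  shows "x = y"
proof (cases "y = 0")
  case True
  with assms show ?thesis by (simp add: zero_power)
next
  case False
  define u where "u = x / y"
  have us: "u ^ s = 1"
    using assms False by (simp add: u_def power_divide)
  have "\<phi> u = u"
    using assms by (simp add: u_def frob_simps)
  moreover have "u \<noteq> 0"
    using us assms(2) by (auto simp: zero_power)
  moreover have "\<phi> u = u * u ^ (q - 1)"
    using q_gt_1 by (simp add: frob flip: power_Suc)
  ultimately have uq: "u ^ (q - 1) = 1"
    by simp
  obtain i j where "s * i = (q - 1) * j + 1"
    using bezout_nat[of s "q - 1"] assms by auto
  then have "u ^ (s * i) = u ^ ((q - 1) * j + 1)"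
    by simp
  then have "u = 1"
    using us uq by (simp add: power_add power_mult)
  with False show ?thesis
    by (simp add: u_def)
qed

section \<open>Factorization through three traces and the bijectivity criterion\<close>

text \<open>With a = w / \<phi>(w), each coefficient on the left is a sum of two ratios of
  conjugates of \<open>w\<close>, one over \<phi>(\<phi>(w)) and one over \<phi>(w). Grouping by
  denominator produces the two traces.\<close>

lemma trace_decomposition:
  assumes "w \<noteq> 0" "w = a * \<phi> w"
  shows "2 * \<phi> (\<phi> x) + (a + \<phi> a) * \<phi> x + (a * \<phi> (\<phi> a) + a * \<phi> a) * x
    = tr (w * x) * \<phi> (\<phi> (1 / w)) + tr (\<phi> (\<phi> w) * x) * \<phi> (1 / w)"
proof -
  have a: "a = w / \<phi> w"
    using assms by (simp add: field_simps)
  show ?thesis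
    using assms(1) unfolding a tr_def by (simp add: frob_simps field_simps)
qed

theorem bij_iff_disc:
  assumes w: "w \<noteq> 0" and s: "s > 0"
  defines "F \<equiv> \<lambda>x. tr (w * x) * \<phi> (\<phi> (1 / w)) + tr (\<phi> (\<phi> w) * x) * \<phi> (1 / w) + tr x ^ s"
  shows "bij F \<longleftrightarrow> disc w \<noteq> 0 \<and> disc (1 / w) \<noteq> 0 \<and> gcd s (q - 1) = 1"
proof
  assume bij: "bij F"
  have disc_w: "disc w \<noteq> 0"
  proof
    assume "disc w = 0"
    then obtain d where d: "d \<noteq> 0" "tr d = 0" "tr (w * d) = 0" "tr (\<phi> (\<phi> w) * d) = 0"
      by (rule disc_eq_0_imp_kernel)
    then have "F d = F 0"
      by (simp add: F_def tr_def)
    with bij d(1) show False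
      by (simp add: bij_def inj_eq)
  qed
  moreover have "disc (1 / w) \<noteq> 0"
  proof
    define v where "v = 1 / w"
    assume "disc (1 / w) = 0"
    then obtain d where d: "d \<noteq> 0" "tr d = 0" "tr (v * d) = 0" "tr (\<phi> (\<phi> v) * d) = 0"
      unfolding v_def by (rule disc_eq_0_imp_kernel)
    \<comment> \<open>The shift by \<open>\<phi>\<close> twice turns the kernel conditions on
      \<open>d\<close> into orthogonality of \<open>e\<close>, under the trace form, to
      \<phi>(\<phi>(v)), \<phi>(v) and 1. The image of \<open>F\<close> then lies in the hyperplane
      tr(e y) = 0, against surjectivity.\<close>
    define e where "e = \<phi> (\<phi> d)"
    have e: "tr e = 0" "tr (\<phi> (\<phi> v) * e) = 0" "tr (\<phi> v * e) = 0"
      using d(2-4) by (simp_all add: e_def tr_def frob_simps add_ac)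
    have "e * F x = tr (w * x) * (\<phi> (\<phi> v) * e)
        + tr (\<phi> (\<phi> w) * x) * (\<phi> v * e) + tr x ^ s * e" for x
      unfolding F_def v_def[symmetric] by (simp only: distrib_left mult_ac)
    then have "tr (e * F x) = tr (w * x) * tr (\<phi> (\<phi> v) * e)
        + tr (\<phi> (\<phi> w) * x) * tr (\<phi> v * e) + tr x ^ s * tr e" for x
      by (simp only: tr_add tr_scale frob_tr frob_power)
    then have "tr (e * F x) = 0" for x
      using e by simp
    then have "tr (e * y) = 0" for y
      using bij by (metis bij_pointE)
    then have "e * y + \<phi> e * \<phi> y + \<phi> (\<phi> e) * \<phi> (\<phi> y) = 0" for y
      by (simp add: tr_def frob_mult)
    from vanishing_coeffs(1)[OF this] d(1) show False
      by (simp add: e_def)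
  qed
  moreover have "gcd s (q - 1) = 1"
  proof (rule ccontr)
    assume "gcd s (q - 1) \<noteq> 1"
    then obtain z where z: "z \<noteq> 1" "\<phi> z = z" "z ^ s = 1"
      by (rule nontrivial_root_of_unity)
    \<comment> \<open>A third cofactor divided by the determinant: it solves the trace system with
      right-hand side (0, 0, 1). Scaling it by \<open>z\<close> changes only tr(d), whose
      \<open>s\<close>-th power stays 1, so \<open>F\<close> has a collision.\<close>
    define d where "d = ((\<phi> w)\<^sup>2 - w * \<phi> (\<phi> w)) / disc w"
    have d: "tr d = 1" "tr (w * d) = 0" "tr (\<phi> (\<phi> w) * d) = 0"
    proof -
      have num: "d = (1 / disc w) * ((\<phi> w)\<^sup>2 - w * \<phi> (\<phi> w))"
        by (simp add: d_def)
      have inv: "\<phi> (1 / disc w) = 1 / disc w"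
        by (simp add: frob_divide frob_disc)
      have "tr ((\<phi> w)\<^sup>2 - w * \<phi> (\<phi> w)) = disc w"
        by (simp add: tr_def disc_def frob_simps)
      then show "tr d = 1"
        unfolding num tr_scale[OF inv] using disc_w by simp
      have "tr (w * ((\<phi> w)\<^sup>2 - w * \<phi> (\<phi> w))) = 0"
        "tr (\<phi> (\<phi> w) * ((\<phi> w)\<^sup>2 - w * \<phi> (\<phi> w))) = 0"
        by (simp_all add: tr_def frob_simps power2_eq_square algebra_simps)
      then show "tr (w * d) = 0" "tr (\<phi> (\<phi> w) * d) = 0"
        unfolding num mult.left_commute[of _ "1 / disc w"] tr_scale[OF inv] by simp_all
    qed
    have "F (z * d) = F d"
      by (simp add: F_def tr_scale[OF z(2)] d z(3) mult.left_commute[of _ z])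
    then have "z * d = d"
      using bij by (simp add: bij_def inj_eq)
    with d(1) z(1) show False
      by (auto simp: tr_def)
  qed
  ultimately show "disc w \<noteq> 0 \<and> disc (1 / w) \<noteq> 0 \<and> gcd s (q - 1) = 1"
    by blast
next
  assume *: "disc w \<noteq> 0 \<and> disc (1 / w) \<noteq> 0 \<and> gcd s (q - 1) = 1"
  have "inj F"
  proof (rule injI)
    fix x y
    assume eq: "F x = F y"
    have fixed: "\<phi> (tr (c * x) - tr (c * y)) = tr (c * x) - tr (c * y)"
      "\<phi> (tr x ^ s - tr y ^ s) = tr x ^ s - tr y ^ s" for c
      by (simp_all add: frob_simps frob_tr)
    \<comment> \<open>The equality F x = F y becomes a linear relation between \<phi>(\<phi>(1/w)),
      \<phi>(1/w) and 1 with coefficients fixed by \<open>\<phi>\<close>.\<close>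
    have "(tr (w * x) - tr (w * y)) * \<phi> (\<phi> (1 / w))
        + (tr (\<phi> (\<phi> w) * x) - tr (\<phi> (\<phi> w) * y)) * \<phi> (1 / w) + (tr x ^ s - tr y ^ s) = F x - F y"
      unfolding F_def by (simp only: left_diff_distrib add_diff_add)
    also have "\<dots> = 0"
      using eq by simp
    finally have rel: "(tr (w * x) - tr (w * y)) * \<phi> (\<phi> (1 / w))
        + (tr (\<phi> (\<phi> w) * x) - tr (\<phi> (\<phi> w) * y)) * \<phi> (1 / w) + (tr x ^ s - tr y ^ s) = 0" .
    have eqs: "tr (w * x) - tr (w * y) = 0" "tr (\<phi> (\<phi> w) * x) - tr (\<phi> (\<phi> w) * y) = 0"
      and "tr x ^ s - tr y ^ s = 0"
      using disc_neq_0_imp_independent[OF _ fixed(1) fixed(1) fixed(2) rel] * by blast+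
    then have "tr x ^ s = tr y ^ s"
      by simp
    with * s have "tr x = tr y"
      by (intro power_inject_fixed[of s "tr x" "tr y"] frob_tr) auto
    then have "tr (x - y) = 0" "tr (w * (x - y)) = 0" "tr (\<phi> (\<phi> w) * (x - y)) = 0"
      using eqs by (simp_all only: right_diff_distrib tr_diff diff_self)
    then have "x - y = 0"
      using * disc_neq_0_imp_trivial_kernel by blast
    then show "x = y"
      by simp
  qed
  then show "bij F"
    by (simp add: bij_def finite_UNIV_inj_surj)
qed

text \<open>This eliminates the auxiliary \<open>w\<close>. Since \<open>disc\<close> is homogeneous
  of degree 2, dividing by a square leaves only ratios of conjugates, and these are
  \<open>a\<close>, \<open>b\<close> and \<open>a * b\<close>.\<close>

theorem permutation_poly_f2_iff:
  assumes norm: "a * \<phi> a * \<phi> (\<phi> a) = 1" and s: "s > 0"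
  defines "b \<equiv> a ^ q"
  shows "permutation_poly (f2 q s a) \<longleftrightarrow>
    (a * b)\<^sup>2 + b\<^sup>2 + 1 - a * b * b - a * b - b \<noteq> 0 \<and>
    (a * b)\<^sup>2 + a\<^sup>2 + 1 - a * b * a - a * b - a \<noteq> 0 \<and> gcd s (q - 1) = 1"
proof -
  obtain w where w: "w \<noteq> 0" "w = a * \<phi> w"
    using norm by (rule hilbert_90)
  have a: "a = w / \<phi> w"
    using w by (simp add: field_simps)
  have b: "b = \<phi> w / \<phi> (\<phi> w)"
    unfolding b_def frob[symmetric] a by (simp add: frob_divide)
  have "poly (f2 q s a) = (\<lambda>x. tr (w * x) * \<phi> (\<phi> (1 / w)) + tr (\<phi> (\<phi> w) * x) * \<phi> (1 / w) + tr x ^ s)"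
    unfolding trace_decomposition[OF w, symmetric]
    by (simp add: fun_eq_iff f2_def trace_poly_def poly_monom poly_power tr_def power_add
        flip: frob_square frob)
  then have "permutation_poly (f2 q s a) \<longleftrightarrow> disc w \<noteq> 0 \<and> disc (1 / w) \<noteq> 0 \<and> gcd s (q - 1) = 1"
    using bij_iff_disc[OF w(1) s] by (simp add: permutation_poly_def)
  moreover have "(a * b)\<^sup>2 + b\<^sup>2 + 1 - a * b * b - a * b - b = disc w / (\<phi> (\<phi> w))\<^sup>2"
    using w(1) unfolding a b disc_def by (simp add: field_simps power2_eq_square)
  moreover have "(a * b)\<^sup>2 + a\<^sup>2 + 1 - a * b * a - a * b - a = w\<^sup>2 * disc (1 / w)"
    using w(1) unfolding a b disc_def by (simp add: frob_divide field_simps power2_eq_square)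
  ultimately show ?thesis
    using w(1) by simp
qed

end

section \<open>The two quadratic conditions for each residue of q modulo 3\<close>

theorem theorem3p2:
  fixes p m q s :: nat and a :: "'a::finite_field"
  assumes "prime p" and "odd p" and "m > 0" and "q = p ^ m"
    and "CARD('a) = q ^ 3"
    and "s > 1"
    and "a \<in> roots_of_unity (q ^ 2 + q + 1)"
  shows
    "([q = 0] (mod 3) \<longrightarrow>
        (permutation_poly (f2 q s a) \<longleftrightarrow>
          a ^ (q + 1) + a + 1 \<noteq> 0 \<and>
          a ^ (q + 1) + a ^ q + 1 \<noteq> 0 \<and>
          gcd s (q - 1) = 1)) \<and>
     ([q = 1] (mod 3) \<longrightarrow>
        (\<forall>\<alpha> \<beta> :: 'a. \<alpha> ^ 2 = -3 \<and> \<beta> ^ 2 = -3 \<longrightarrow>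
          (permutation_poly (f2 q s a) \<longleftrightarrow>
            a ^ (q + 1) + (1 + \<alpha>) / (1 - \<alpha>) * a - 2 / (1 - \<alpha>) \<noteq> 0 \<and>
            a ^ (q + 1) + (1 - \<alpha>) / (1 + \<alpha>) * a - 2 / (1 + \<alpha>) \<noteq> 0 \<and>
            2 * a ^ (q + 1) - (1 - \<beta>) * a ^ q - (1 + \<beta>) \<noteq> 0 \<and>
            2 * a ^ (q + 1) - (1 + \<beta>) * a ^ q - (1 - \<beta>) \<noteq> 0 \<and>
            gcd s (q - 1) = 1))) \<and>
     ([q = 2] (mod 3) \<longrightarrow>
        (permutation_poly (f2 q s a) \<longleftrightarrow> a \<noteq> 1 \<and> gcd s (q - 1) = 1))"
proof -
  have three_prime: "prime (3 :: nat)"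
    by simp
  define b where "b = a ^ q"
  let ?E = "(a * b)\<^sup>2 + b\<^sup>2 + 1 - a * b * b - a * b - b"
  let ?E' = "(a * b)\<^sup>2 + a\<^sup>2 + 1 - a * b * a - a * b - a"
  have "CHAR('a) dvd p ^ (m * 3)"
    using CHAR_dvd_CARD[where ?'a = 'a] assms(4,5) by (simp add: power_mult)
  then have char: "CHAR('a) = p"
    using assms(1) by (metis CHAR_prime prime_dvd_power primes_dvd_imp_eq)
  have n0: "of_nat k \<noteq> (0 :: 'a)" if "\<not> p dvd k" for k
    using that char by (simp add: of_nat_eq_0_iff_char_dvd)
  have "\<not> p dvd 2"
    using primes_dvd_imp_eq[OF assms(1) two_is_prime_nat] assms(2) by auto
  from n0[OF this] have two: "(2 :: 'a) \<noteq> 0"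
    by simp
  interpret cubic_frobenius q "\<lambda>x :: 'a. x ^ q"
    by standard (use assms char in \<open>auto intro: freshmans_dream'\<close>)
  have "a * a ^ q * (a ^ q) ^ q = 1"
    using assms(7) by (simp add: roots_of_unity_def power_add power2_eq_square power_mult mult_ac)
  then have perm: "permutation_poly (f2 q s a) \<longleftrightarrow> ?E \<noteq> 0 \<and> ?E' \<noteq> 0 \<and> gcd s (q - 1) = 1"
    using permutation_poly_f2_iff[of a s] assms(6) by (simp add: b_def)
  have three: "(3 :: 'a) \<noteq> 0" if "\<not> 3 dvd q"
  proof -
    have "p \<noteq> 3"
      using that assms(3,4) by (auto intro: dvd_power)
    then have "\<not> p dvd 3"
      using primes_dvd_imp_eq[OF assms(1) three_prime] by blast
    from n0[OF this] show ?thesis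
      by simp
  qed
  show ?thesis
  proof (intro conjI impI allI)
    assume "[q = 0] (mod 3)"
    then have "3 dvd p"
      using assms(4) by (metis cong_0_iff prime_dvd_power three_prime)
    then have "p = 3"
      using primes_dvd_imp_eq[OF three_prime assms(1)] by simp
    then have "(of_nat 3 :: 'a) = 0"
      unfolding of_nat_eq_0_iff_char_dvd by (simp add: char)
    then have three: "(3 :: 'a) = 0"
      by simp
    \<comment> \<open>Each form differs from a perfect square by a multiple of 3, which is zero in
      characteristic 3.\<close>
    have "?E = (a * b + b + 1)\<^sup>2 - 3 * (a * b * b + a * b + b)"
      "?E' = (a * b + a + 1)\<^sup>2 - 3 * (a * b * a + a * b + a)"
      by (simp_all add: power2_eq_square algebra_simps)
    then have "?E = (a * b + b + 1)\<^sup>2" "?E' = (a * b + a + 1)\<^sup>2"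
      unfolding three by simp_all
    then show "permutation_poly (f2 q s a) \<longleftrightarrow>
        a ^ (q + 1) + a + 1 \<noteq> 0 \<and> a ^ (q + 1) + a ^ q + 1 \<noteq> 0 \<and> gcd s (q - 1) = 1"
      unfolding perm by (auto simp: b_def)
  next
    fix \<alpha> \<beta> :: 'a
    assume "[q = 1] (mod 3)" and "\<alpha> ^ 2 = -3 \<and> \<beta> ^ 2 = -3"
    then have sq: "\<alpha> ^ 2 = -3" "\<beta> ^ 2 = -3" by auto
    have four: "(2 :: 'a) * 2 \<noteq> 0"
      using two by (metis mult_eq_0_iff)
    have "(1 - \<alpha>) * (1 + \<alpha>) = 1 - \<alpha>\<^sup>2"
      by (simp add: power2_eq_square algebra_simps)
    then have prod: "(1 - \<alpha>) * (1 + \<alpha>) = 2 * 2"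
      using sq(1) by simp
    then have nz: "1 - \<alpha> \<noteq> 0" "1 + \<alpha> \<noteq> 0"
      using four by (metis mult_zero_left mult_zero_right)+
    \<comment> \<open>Completing the square in \<open>a * b\<close> writes 4 \<open>?E\<close> as a
      square plus 3 (b - 1)^2. As -3 = \<beta>^2, this is a difference of squares and
      splits.\<close>
    have "(2 * (a * b) - (1 - \<beta>) * b - (1 + \<beta>)) * (2 * (a * b) - (1 + \<beta>) * b - (1 - \<beta>))
        = (2 * (a * b) - b - 1)\<^sup>2 - \<beta>\<^sup>2 * (b - 1)\<^sup>2"
      by (simp add: power2_eq_square algebra_simps)
    also have "\<dots> = 2 * 2 * ?E"
      unfolding sq by (simp add: power2_eq_square algebra_simps)
    finally have "2 * 2 * ?E = (2 * (a * b) - (1 - \<beta>) * b - (1 + \<beta>)) * (2 * (a * b) - (1 + \<beta>) * b - (1 - \<beta>))"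
      by (rule sym)
    then have E: "?E = 0 \<longleftrightarrow> (2 * (a * b) - (1 - \<beta>) * b - (1 + \<beta>)) * (2 * (a * b) - (1 + \<beta>) * b - (1 - \<beta>)) = 0"
      using two by (metis mult_eq_0_iff)
    define X where "X = a * b + (1 + \<alpha>) / (1 - \<alpha>) * a - 2 / (1 - \<alpha>)"
    define Y where "Y = a * b + (1 - \<alpha>) / (1 + \<alpha>) * a - 2 / (1 + \<alpha>)"
    have clear: "D * (a * b + N / D * a - 2 / D) = D * (a * b) + N * a - 2" if "D \<noteq> 0" for D N :: 'a
      using that by (simp add: distrib_left right_diff_distrib)
    have X: "(1 - \<alpha>) * X = (1 - \<alpha>) * (a * b) + (1 + \<alpha>) * a - 2"
      unfolding X_def using nz by (intro clear)
    have Y: "(1 + \<alpha>) * Y = (1 + \<alpha>) * (a * b) + (1 - \<alpha>) * a - 2"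
      unfolding Y_def using nz by (intro clear)
    \<comment> \<open>With denominators cleared, the factors are (ab + a - 2) minus and plus
      \<alpha> (ab - a).\<close>
    have "((1 - \<alpha>) * X) * ((1 + \<alpha>) * Y) = (a * b + a - 2)\<^sup>2 - \<alpha>\<^sup>2 * (a * b - a)\<^sup>2"
      unfolding X Y by (simp add: power2_eq_square algebra_simps)
    also have "\<dots> = 2 * 2 * ?E'"
      unfolding sq by (simp add: power2_eq_square algebra_simps)
    finally have "2 * 2 * ?E' = ((1 - \<alpha>) * X) * ((1 + \<alpha>) * Y)"
      by (rule sym)
    then have E': "?E' = 0 \<longleftrightarrow> X * Y = 0"
      using two nz by (metis mult_eq_0_iff)
    show "permutation_poly (f2 q s a) \<longleftrightarrow>
        a ^ (q + 1) + (1 + \<alpha>) / (1 - \<alpha>) * a - 2 / (1 - \<alpha>) \<noteq> 0 \<and>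
        a ^ (q + 1) + (1 - \<alpha>) / (1 + \<alpha>) * a - 2 / (1 + \<alpha>) \<noteq> 0 \<and>
        2 * a ^ (q + 1) - (1 - \<beta>) * a ^ q - (1 + \<beta>) \<noteq> 0 \<and>
        2 * a ^ (q + 1) - (1 + \<beta>) * a ^ q - (1 - \<beta>) \<noteq> 0 \<and> gcd s (q - 1) = 1"
      unfolding perm E E' X_def Y_def mult_eq_0_iff by (auto simp: b_def)
  next
    assume "[q = 2] (mod 3)"
    then have q: "q mod 3 = 2"
      by (simp add: cong_def)
    then have three: "(3 :: 'a) \<noteq> 0"
      using three by (simp add: dvd_eq_mod_eq_0)
    have "q ^ 3 mod 3 = (q mod 3) ^ 3 mod 3"
      by (simp add: power_mod)
    then have "q ^ 3 mod 3 = 2"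
      unfolding q by simp
    then obtain k where k: "q ^ 3 = 3 * k + 2"
      by (metis mult_div_mod_eq)
    \<comment> \<open>Since q^3 = 3 k + 2, the identity u^(q^3) = u reads u^2 = u for a cube root of
      unity: only the trivial one exists.\<close>
    have cube: "u = 1" if "u ^ 3 = 1" for u :: 'a
    proof -
      have "u \<noteq> 0"
        using that by auto
      moreover have "u = u * u"
        using finite_field_power_card_eq_same[of u] that
        unfolding assms(5) k by (simp add: power_add power_mult power2_eq_square)
      ultimately show ?thesis
        by simp
    qed
    \<comment> \<open>The form divides e^3 - d^3, so a nontrivial zero forces e = d and then 3 d^2 =
      0.\<close>
    have anisotropic: "d = 0" if "d\<^sup>2 + d * e + e\<^sup>2 = 0" for d e :: 'a
    proof (rule ccontr)
      assume "d \<noteq> 0"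
      have "(e - d) * (d\<^sup>2 + d * e + e\<^sup>2) = e ^ 3 - d ^ 3"
        by (simp add: power2_eq_square power3_eq_cube algebra_simps)
      then have "e ^ 3 = d ^ 3"
        unfolding that by simp
      then have "(e / d) ^ 3 = 1"
        using \<open>d \<noteq> 0\<close> by (simp only: power_divide) simp
      then have "e / d = 1"
        by (rule cube)
      then have "e = d"
        using \<open>d \<noteq> 0\<close> by simp
      with that have "3 * d\<^sup>2 = 0"
        by (simp add: power2_eq_square)
      with \<open>d \<noteq> 0\<close> three show False
        by simp
    qed
    have "a = 1" if "?E = 0"
    proof -
      \<comment> \<open>\<open>?E\<close> depends only on the differences of ab, b and 1; in terms
        of ab - b and b - 1 it is the anisotropic form.\<close>
      have "(b * (a - 1))\<^sup>2 + (b * (a - 1)) * (b - 1) + (b - 1)\<^sup>2 = ?E"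
        by (simp add: power2_eq_square algebra_simps)
      then have "b * (a - 1) = 0"
        unfolding that by (rule anisotropic)
      moreover have "b \<noteq> 0"
        using that by auto
      ultimately show ?thesis
        by simp
    qed
    moreover have "a = 1" if "?E' = 0"
    proof -
      have "(a - 1)\<^sup>2 + (a - 1) * (a * (b - 1)) + (a * (b - 1))\<^sup>2 = ?E'"
        by (simp add: power2_eq_square algebra_simps)
      then have "a - 1 = 0"
        unfolding that by (rule anisotropic)
      then show ?thesis
        by simp
    qed
    moreover have "?E = 0" if "a = 1"
      using that by (simp add: b_def)
    ultimately show "permutation_poly (f2 q s a) \<longleftrightarrow> a \<noteq> 1 \<and> gcd s (q - 1) = 1"
      unfolding perm by blast
  qed
qed

end
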